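(* Let $m=m_n\to\infty$ and $p=p_n\to 0$ satisfy $mp^2=o(1)$, $n^2mp^2\to\infty$, $n=o(m)$, and $np/\ln\frac{m}{n}\to\infty$ as $n\to\infty$. Then for any function $\omega=\omega_n\to\infty$, with high probability $$\operatorname{mod}(\mathcal{G}(n,m,p))=O\left(\left(\frac{\ln(m/n)}{np}\right)^{1/2}+\frac{n}{m}+\omega mp^2\right).$$
   Context: The random intersection graph $\mathcal{G}(n,m,p)$: there is a vertex set $\mathcal{V}=\{v_1,\dots,v_n\}$ and an attribute set $\mathcal{W}=\{w_1,\dots,w_m\}$. Each vertex $v_i$ receives a random subset $\mathcal{W}(v_i)\subseteq\mathcal{W}$, where each attribute is included independently with probability $p$ (independently over all vertex–attribute pairs). Two distinct vertices are adjacent iff their attribute sets intersect. Modularity: for a graph $G$ with at least one edge, $e(G)$ is its number of edges, $e(S)$ the number of edges inside $S\subseteq V(G)$, $\operatorname{vol}(S)$ the sum of degrees of vertices of $S$, $\operatorname{vol}(G)=\operatorname{vol}(V(G))$; $\operatorname{mod}(G)=\max_{\mathcal{A}}\sum_{S\in\mathcal{A}}\left(\frac{e(S)}{e(G)}-\left(\frac{\operatorname{vol}(S)}{\operatorname{vol}(G)}\right)^2\right)$ over all partitions $\mathcal{A}$ of $V(G)$. "With high probability" means with probability tending to $1$ as $n\to\infty$. *)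

theory Defs
  imports "HOL-Probability.Probability" "HOL-Library.Landau_Symbols"
begin

text \<open>
  A finite simple graph is a pair of a vertex set and an edge set, each edge being
  a two-element set of vertices.
\<close>

type_synonym 'a graph = "'a set \<times> 'a set set"

abbreviation verts :: "'a graph \<Rightarrow> 'a set" where "verts \<equiv> fst"
abbreviation edges :: "'a graph \<Rightarrow> 'a set set" where "edges \<equiv> snd"

definition deg :: "'a graph \<Rightarrow> 'a \<Rightarrow> nat" where
  "deg G v = card {e \<in> edges G. v \<in> e}"

definition edges_inside :: "'a graph \<Rightarrow> 'a set \<Rightarrow> nat" where
  "edges_inside G S = card {e \<in> edges G. e \<subseteq> S}"

definition vol :: "'a graph \<Rightarrow> 'a set \<Rightarrow> nat" where
  "vol G S = (\<Sum>v\<in>S. deg G v)"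

definition partition_score :: "'a graph \<Rightarrow> 'a set set \<Rightarrow> real" where
  "partition_score G \<A> =
     (\<Sum>S\<in>\<A>. real (edges_inside G S) / real (card (edges G))
             - (real (vol G S) / real (vol G (verts G)))\<^sup>2)"

text \<open>
  Meaningful for finite graphs with at least one edge. On an edgeless graph the value is 0,
  because division by zero yields 0.
\<close>

definition modularity :: "'a graph \<Rightarrow> real" where
  "modularity G = Max {partition_score G \<A> | \<A>. partition_on (verts G) \<A>}"

text \<open>
  An attribute assignment \<open>X\<close> is encoded by its incidence table: \<open>X (v, w)\<close> holds iff vertex
  \<open>v\<close> has attribute \<open>w\<close>. Vertices are \<open>0, \<dots>, n - 1\<close> and attributes are \<open>0, \<dots>, m - 1\<close>.
\<close>

definition attributes_of :: "nat \<Rightarrow> (nat \<times> nat \<Rightarrow> bool) \<Rightarrow> nat \<Rightarrow> nat set" where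
  "attributes_of m X v = {w \<in> {..<m}. X (v, w)}"

definition intersection_graph :: "nat \<Rightarrow> nat \<Rightarrow> (nat \<times> nat \<Rightarrow> bool) \<Rightarrow> nat graph" where
  "intersection_graph n m X =
     ({..<n}, {{u, v} | u v. u < n \<and> v < n \<and> u \<noteq> v \<and>
                             attributes_of m X u \<inter> attributes_of m X v \<noteq> {}})"

definition random_intersection_graph :: "nat \<Rightarrow> nat \<Rightarrow> real \<Rightarrow> nat graph pmf" where
  "random_intersection_graph n m p =
     map_pmf (intersection_graph n m)
       (Pi_pmf ({..<n} \<times> {..<m}) False (\<lambda>_. bernoulli_pmf p))"

end

theory Submission
  imports Defs "HOL-Real_Asymp.Real_Asymp"
begin

text \<open>
  Merging the parts of a partition at random into two groups shows that the modularity is at most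
  four times the largest value of \<open>e(S)/e(G) - (vol(S)/vol(G))\<^sup>2\<close> over single vertex sets \<open>S\<close>.
  Put \<open>\<epsilon> = sqrt (ln (m/n) / (np))\<close>. By a Chernoff bound, a fixed attribute meets \<open>S\<close> in more than
  \<open>p|S| + 2\<epsilon>np\<close> vertices with probability at most \<open>n/m\<close>, so a union bound over the
  \<open>2\<^sup>n\<close> sets shows that with high probability every \<open>S\<close> has at most \<open>5n\<close> such attributes. Summing
  squares of occupancies bounds \<open>2e(S)\<close> by \<open>(|S|/n)\<^sup>2\<mu> + O((\<epsilon> + n/m)\<mu>)\<close> with \<open>\<mu> = m(np)\<^sup>2\<close>. Second moment
  bounds for the numbers of vertices per attribute and of attributes per vertex give
  \<open>vol(S) \<ge> (|S|/n)\<mu> - O(\<epsilon>\<mu>)\<close> when edges are counted with multiplicity, and by Markov's inequality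
  passing to the simple graph costs at most \<open>\<omega>mp\<^sup>2\<mu>\<close>.
\<close>

section \<open>Modularity and single vertex sets\<close>

lemma card_supersets_in_Pow:
  assumes "finite A" "C \<subseteq> A"
  shows "card {U \<in> Pow A. C \<subseteq> U} = 2 ^ card (A - C)"
proof -
  have "bij_betw (\<lambda>U. U - C) {U \<in> Pow A. C \<subseteq> U} (Pow (A - C))"
    by (rule bij_betwI[where g = "\<lambda>U. U \<union> C"]) (use assms in auto)
  then show ?thesis
    using assms by (simp add: bij_betw_same_card card_Pow)
qed

text \<open>A uniformly random subfamily contains a given part with probability \<open>1/2\<close> and a given pair
  of distinct parts with probability \<open>1/4\<close>, so the average of the restricted double sum is
  a quarter of the diagonal sum plus a quarter of the full sum.\<close>

lemma sum_diagonal_le_of_subfamilies: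
  fixes b :: "'a \<Rightarrow> 'a \<Rightarrow> real"
  assumes fin: "finite A" and zero: "(\<Sum>P\<in>A. \<Sum>Q\<in>A. b P Q) = 0"
    and le: "\<And>U. U \<subseteq> A \<Longrightarrow> (\<Sum>P\<in>U. \<Sum>Q\<in>U. b P Q) \<le> \<eta>"
  shows "(\<Sum>P\<in>A. b P P) \<le> 4 * \<eta>"
proof -
  have count: "4 * real (card {U \<in> Pow A. {P, Q} \<subseteq> U}) = 2 ^ card A * (1 + of_bool (P = Q))"
    if PQ: "P \<in> A" "Q \<in> A" for P Q
  proof -
    have "card (A - {P, Q}) + card {P, Q} = card A"
      using fin PQ by (metis card_Diff_subset card_mono empty_subsetI finite.emptyI finite.insertI
          insert_subset le_add_diff_inverse2)
    then have "(2::real) ^ card A = 2 ^ card (A - {P, Q}) * 2 ^ card {P, Q}"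
      by (metis power_add)
    moreover have "card {U \<in> Pow A. {P, Q} \<subseteq> U} = 2 ^ card (A - {P, Q})"
      using fin PQ by (intro card_supersets_in_Pow) auto
    ultimately show ?thesis by (cases "P = Q") simp_all
  qed
  have restrict: "(\<Sum>P\<in>U. \<Sum>Q\<in>U. b P Q)
      = (\<Sum>P\<in>A. \<Sum>Q\<in>A. of_bool ({P, Q} \<subseteq> U) * b P Q)" if "U \<subseteq> A" for U
  proof -
    have "(\<Sum>P\<in>A. \<Sum>Q\<in>A. of_bool ({P, Q} \<subseteq> U) * b P Q)
      = (\<Sum>P\<in>A. if P \<in> U then (\<Sum>Q\<in>A. if Q \<in> U then b P Q else 0) else 0)"
      by (intro sum.cong refl) (auto intro: sum.cong)
    also have "\<dots> = (\<Sum>P\<in>A \<inter> U. \<Sum>Q\<in>A \<inter> U. b P Q)"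
      using fin by (simp add: sum.inter_restrict)
    finally show ?thesis using that by (simp add: Int_absorb1)
  qed
  have "4 * (\<Sum>U\<in>Pow A. \<Sum>P\<in>U. \<Sum>Q\<in>U. b P Q)
      = 4 * (\<Sum>U\<in>Pow A. \<Sum>P\<in>A. \<Sum>Q\<in>A. of_bool ({P, Q} \<subseteq> U) * b P Q)"
    by (rule arg_cong[where f = "(*) 4"], rule sum.cong[OF refl], rule restrict) simp
  also have "\<dots> = (\<Sum>P\<in>A. \<Sum>Q\<in>A. 4 * real (card {U \<in> Pow A. {P, Q} \<subseteq> U}) * b P Q)"
  proof -
    have "(\<Sum>U\<in>Pow A. \<Sum>P\<in>A. \<Sum>Q\<in>A. of_bool ({P, Q} \<subseteq> U) * b P Q)
      = (\<Sum>P\<in>A. \<Sum>Q\<in>A. \<Sum>U\<in>Pow A. of_bool ({P, Q} \<subseteq> U) * b P Q)"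
      by (subst sum.swap, rule sum.cong[OF refl], subst sum.swap) simp
    also have "\<dots> = (\<Sum>P\<in>A. \<Sum>Q\<in>A. real (card {U \<in> Pow A. {P, Q} \<subseteq> U}) * b P Q)"
      using fin by (simp flip: sum_distrib_right add: sum_of_bool_eq Int_def)
    finally show ?thesis by (simp add: sum_distrib_left mult.assoc)
  qed
  also have "\<dots> = (\<Sum>P\<in>A. \<Sum>Q\<in>A. 2 ^ card A * b P Q + (if P = Q then 2 ^ card A * b P Q else 0))"
    by (intro sum.cong refl) (simp only: count, simp add: algebra_simps)
  also have "\<dots> = 2 ^ card A * (\<Sum>P\<in>A. \<Sum>Q\<in>A. b P Q) + 2 ^ card A * (\<Sum>P\<in>A. b P P)"
    using fin by (simp add: sum.distrib sum_distrib_left)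
  finally have "2 ^ card A * (\<Sum>P\<in>A. b P P) = 4 * (\<Sum>U\<in>Pow A. \<Sum>P\<in>U. \<Sum>Q\<in>U. b P Q)"
    using zero by simp
  also have "\<dots> \<le> 4 * (\<Sum>U\<in>Pow A. \<eta>)"
    by (intro mult_left_mono sum_mono le) auto
  also have "\<dots> = 2 ^ card A * (4 * \<eta>)"
    using fin by (simp add: card_Pow)
  finally show ?thesis by simp
qed

section \<open>Edge counts and volumes as double sums over adjacency\<close>

locale fin_graph =
  fixes G :: "'a graph"
  assumes finite_verts: "finite (verts G)"
    and edge_subset: "e \<in> edges G \<Longrightarrow> e \<subseteq> verts G"
    and card_edge: "e \<in> edges G \<Longrightarrow> card e = 2"
begin

text \<open>By \<open>card_edge\<close> no singleton \<open>{u, u}\<close> is an edge, so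
  \<open>adj u u\<close> vanishes and double sums may run over all pairs, including the
  diagonal.\<close>

abbreviation adj :: "'a \<Rightarrow> 'a \<Rightarrow> real" where
  "adj u v \<equiv> of_bool ({u, v} \<in> edges G)"

lemma finite_edges: "finite (edges G)"
  by (rule finite_subset[of _ "Pow (verts G)"]) (use finite_verts edge_subset in auto)

lemma deg_eq_sum_adj:
  assumes "v \<in> verts G"
  shows "real (deg G v) = (\<Sum>u\<in>verts G. adj v u)"
proof -
  have "bij_betw (\<lambda>u. {v, u}) {u \<in> verts G. {v, u} \<in> edges G} {e \<in> edges G. v \<in> e}"
  proof (rule bij_betw_imageI)
    show "inj_on (\<lambda>u. {v, u}) {u \<in> verts G. {v, u} \<in> edges G}"
      by (auto simp: inj_on_def doubleton_eq_iff)
    show "(\<lambda>u. {v, u}) ` {u \<in> verts G. {v, u} \<in> edges G} = {e \<in> edges G. v \<in> e}"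
    proof (intro equalityI subsetI)
      fix e assume e: "e \<in> {e \<in> edges G. v \<in> e}"
      then obtain a b where "e = {a, b}" using card_edge by (metis (lifting) card_2_iff mem_Collect_eq)
      with e edge_subset[of e] show "e \<in> (\<lambda>u. {v, u}) ` {u \<in> verts G. {v, u} \<in> edges G}"
        by (auto simp: insert_commute)
    qed auto
  qed
  then show ?thesis
    using finite_verts by (simp add: deg_def bij_betw_same_card sum_of_bool_eq Int_def conj_commute)
qed

lemma vol_eq_sum_adj:
  assumes "S \<subseteq> verts G"
  shows "real (vol G S) = (\<Sum>u\<in>S. \<Sum>v\<in>verts G. adj u v)"
  using assms deg_eq_sum_adj by (auto simp: vol_def intro!: sum.cong)

text \<open>Every edge is \<open>{u, v}\<close> for exactly two ordered pairs, and the sets of pairs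
  belonging to different edges are disjoint.\<close>

lemma edges_inside_eq_sum_adj:
  assumes S: "S \<subseteq> verts G"
  shows "2 * real (edges_inside G S) = (\<Sum>u\<in>S. \<Sum>v\<in>S. adj u v)"
proof -
  let ?E = "{e \<in> edges G. e \<subseteq> S}"
  let ?pairs = "\<lambda>e. {(u, v). {u, v} = e}"
  have finS: "finite S" using finite_subset[OF S finite_verts] .
  have two: "finite (?pairs e) \<and> card (?pairs e) = 2" if e: "e \<in> ?E" for e
  proof -
    have "card e = 2" using e card_edge by simp
    then obtain a b where ab: "e = {a, b}" "a \<noteq> b" by (auto simp: card_2_iff)
    have "?pairs e = {(a, b), (b, a)}"
      unfolding ab(1) by (auto simp: doubleton_eq_iff)
    then show ?thesis using ab(2) by simp
  qed
  have "(\<Sum>u\<in>S. \<Sum>v\<in>S. adj u v) = (\<Sum>z\<in>S \<times> S. of_bool ({fst z, snd z} \<in> edges G))"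
    by (simp add: sum.cartesian_product case_prod_beta)
  also have "\<dots> = real (card (\<Union>e\<in>?E. ?pairs e))"
  proof -
    have "(S \<times> S) \<inter> {z. {fst z, snd z} \<in> edges G} = (\<Union>e\<in>?E. ?pairs e)" by auto
    then show ?thesis using finS by (simp add: sum_of_bool_eq)
  qed
  also have "card (\<Union>e\<in>?E. ?pairs e) = (\<Sum>e\<in>?E. card (?pairs e))"
    using finite_edges two by (intro card_UN_disjoint) auto
  also have "\<dots> = 2 * edges_inside G S"
    by (simp add: two edges_inside_def)
  finally show ?thesis by simp
qed

lemma edges_inside_verts: "edges_inside G (verts G) = card (edges G)"
  using edge_subset by (auto simp: edges_inside_def intro!: arg_cong[where f = card])

lemma vol_verts: "real (vol G (verts G)) = 2 * real (card (edges G))"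
  using vol_eq_sum_adj[of "verts G"] edges_inside_eq_sum_adj[of "verts G"] edges_inside_verts
  by simp

text \<open>The score is the diagonal sum of a bilinear form \<open>b\<close> over the parts. On a
  subfamily the double sum of \<open>b\<close> collapses to \<open>b\<close> at its union, a single
  vertex set bounded by \<open>\<eta>\<close>; on the whole partition it is 0. The averaging over
  subfamilies then applies.\<close>

lemma partition_score_le:
  assumes ne: "edges G \<noteq> {}" and part: "partition_on (verts G) \<A>"
    and le: "\<And>S. S \<subseteq> verts G \<Longrightarrow>
      real (edges_inside G S) / real (card (edges G))
        - (real (vol G S) / real (vol G (verts G)))\<^sup>2 \<le> \<eta>"
  shows "partition_score G \<A> \<le> 4 * \<eta>"
proof -
  let ?V = "verts G" and ?e = "real (card (edges G))"
  \<comment> \<open>This is the normalised modularity matrix: adjacency minus its expectation for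
    the given degrees.\<close>
  define \<beta> where "\<beta> u v = adj u v / (2 * ?e)
      - (\<Sum>x\<in>?V. adj u x) / (2 * ?e) * ((\<Sum>x\<in>?V. adj v x) / (2 * ?e))" for u v
  define b where "b P Q = (\<Sum>u\<in>P. \<Sum>v\<in>Q. \<beta> u v)" for P Q
  have epos: "?e > 0" using ne finite_edges by (simp add: card_gt_0_iff)
  have sets: "P \<subseteq> ?V" "finite P" if "P \<in> \<A>" for P
    using part that finite_verts by (auto simp: partition_on_def intro: finite_subset)
  have finA: "finite \<A>"
    using part finite_verts finite_elements by blast
  have bSS: "b S S = real (edges_inside G S) / ?e - (real (vol G S) / real (vol G ?V))\<^sup>2"
    if "S \<subseteq> ?V" for S
  proof -
    have "b S S = (\<Sum>u\<in>S. \<Sum>v\<in>S. adj u v) / (2 * ?e)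
        - (\<Sum>u\<in>S. (\<Sum>x\<in>?V. adj u x) / (2 * ?e)) * (\<Sum>v\<in>S. (\<Sum>x\<in>?V. adj v x) / (2 * ?e))"
      by (simp only: b_def \<beta>_def sum_subtractf sum_product sum_divide_distrib)
    also have "\<dots> = 2 * real (edges_inside G S) / (2 * ?e)
        - real (vol G S) / (2 * ?e) * (real (vol G S) / (2 * ?e))"
      using that by (simp only: vol_eq_sum_adj edges_inside_eq_sum_adj sum_divide_distrib)
    finally show ?thesis by (simp add: vol_verts power2_eq_square)
  qed
  have bUnion: "(\<Sum>P\<in>U. \<Sum>Q\<in>U. b P Q) = b (\<Union>U) (\<Union>U)" if "U \<subseteq> \<A>" for U
  proof -
    have disj: "\<forall>A\<in>U. \<forall>B\<in>U. A \<noteq> B \<longrightarrow> A \<inter> B = {}"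
      using part that by (meson disjointD partition_onD2 subsetD)
    have "\<forall>A\<in>U. finite A" using sets that by auto
    then have un: "sum g (\<Union>U) = (\<Sum>P\<in>U. sum g P)" for g :: "'a \<Rightarrow> real"
      using sum.Union_disjoint[OF _ disj] by simp
    have "b (\<Union>U) (\<Union>U) = (\<Sum>P\<in>U. \<Sum>u\<in>P. \<Sum>Q\<in>U. \<Sum>v\<in>Q. \<beta> u v)"
      by (simp only: b_def un)
    also have "\<dots> = (\<Sum>P\<in>U. \<Sum>Q\<in>U. b P Q)"
      unfolding b_def by (intro sum.cong refl sum.swap)
    finally show ?thesis ..
  qed
  have "(\<Sum>P\<in>\<A>. b P P) \<le> 4 * \<eta>"
  proof (rule sum_diagonal_le_of_subfamilies[OF finA, where b = b])
    have "\<Union>\<A> = ?V" using part by (simp add: partition_on_def)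
    then have "(\<Sum>P\<in>\<A>. \<Sum>Q\<in>\<A>. b P Q) = b ?V ?V" using bUnion[of \<A>] by simp
    also have "\<dots> = 0"
      using epos by (simp add: bSS edges_inside_verts vol_verts)
    finally show "(\<Sum>P\<in>\<A>. \<Sum>Q\<in>\<A>. b P Q) = 0" .
    fix U assume U: "U \<subseteq> \<A>"
    then have "\<Union>U \<subseteq> ?V" using sets by auto
    then show "(\<Sum>P\<in>U. \<Sum>Q\<in>U. b P Q) \<le> \<eta>"
      using U by (simp add: bUnion bSS le)
  qed
  then show ?thesis
    using sets by (simp add: partition_score_def bSS cong: sum.cong)
qed

text \<open>The one-part partition scores 0, which makes the maximum nonnegative; so the upper bound
  also controls the absolute value.\<close>

lemma abs_modularity_le:
  assumes ne: "edges G \<noteq> {}"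
    and le: "\<And>S. S \<subseteq> verts G \<Longrightarrow>
      real (edges_inside G S) / real (card (edges G))
        - (real (vol G S) / real (vol G (verts G)))\<^sup>2 \<le> \<eta>"
  shows "\<bar>modularity G\<bar> \<le> 4 * \<eta>"
proof -
  let ?scores = "{partition_score G \<A> | \<A>. partition_on (verts G) \<A>}"
  have "{\<A>. partition_on (verts G) \<A>} \<subseteq> Pow (Pow (verts G))"
    by (auto simp: partition_on_def)
  then have "finite {\<A>. partition_on (verts G) \<A>}"
    using finite_verts by (meson finite_Pow_iff finite_subset)
  then have fin: "finite ?scores" by simp
  have "verts G \<noteq> {}" using ne edge_subset card_edge by fastforce
  then have trivial_part: "partition_on (verts G) {verts G}"
    by (simp add: partition_on_space)
  have "card (edges G) \<noteq> 0" using ne finite_edges by simp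
  then have "partition_score G {verts G} = 0"
    by (simp add: partition_score_def edges_inside_verts vol_verts)
  with trivial_part have zero: "0 \<in> ?scores" by force
  then have "0 \<le> modularity G"
    using fin unfolding modularity_def by (intro Max_ge) auto
  moreover have "modularity G \<le> 4 * \<eta>"
    unfolding modularity_def
    using fin zero partition_score_le[OF ne _ le] by (subst Max_le_iff) blast+
  ultimately show ?thesis by simp
qed

end

section \<open>Typical attribute assignments\<close>

definition occ :: "(nat \<times> nat \<Rightarrow> bool) \<Rightarrow> nat set \<Rightarrow> nat \<Rightarrow> real" where
  "occ X S w = (\<Sum>v\<in>S. of_bool (X (v, w)))"

definition num_attrs :: "nat \<Rightarrow> (nat \<times> nat \<Rightarrow> bool) \<Rightarrow> nat \<Rightarrow> real" where
  "num_attrs m X v = (\<Sum>w<m. of_bool (X (v, w)))"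

text \<open>The multiplicity of the pair \<open>u\<close>, \<open>v\<close> when each attribute
  contributes its own clique. For \<open>u = v\<close> it is the number of attributes of
  \<open>u\<close>, a diagonal term that lower bounds on volumes have to remove.\<close>

definition common :: "nat \<Rightarrow> (nat \<times> nat \<Rightarrow> bool) \<Rightarrow> nat \<Rightarrow> nat \<Rightarrow> real" where
  "common m X u v = (\<Sum>w<m. of_bool (X (u, w)) * of_bool (X (v, w)))"

lemma occ_nonneg: "0 \<le> occ X S w"
  by (simp add: occ_def sum_nonneg)

lemma occ_mono: "finite T \<Longrightarrow> S \<subseteq> T \<Longrightarrow> occ X S w \<le> occ X T w"
  unfolding occ_def by (intro sum_mono2) auto

lemma sum_num_attrs: "(\<Sum>v\<in>S. num_attrs m X v) = (\<Sum>w<m. occ X S w)"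
  unfolding num_attrs_def occ_def by (rule sum.swap)

text \<open>Counting pairs one attribute at a time; for \<open>S = T\<close> the result is a sum of
  squared occupancies.\<close>

lemma sum_common: "(\<Sum>u\<in>S. \<Sum>v\<in>T. common m X u v) = (\<Sum>w<m. occ X S w * occ X T w)"
proof -
  have "(\<Sum>u\<in>S. \<Sum>v\<in>T. common m X u v)
      = (\<Sum>u\<in>S. \<Sum>w<m. \<Sum>v\<in>T. of_bool (X (u, w)) * of_bool (X (v, w)))"
    unfolding common_def by (intro sum.cong refl sum.swap)
  also have "\<dots> = (\<Sum>w<m. \<Sum>u\<in>S. \<Sum>v\<in>T. of_bool (X (u, w)) * of_bool (X (v, w)))"
    by (rule sum.swap)
  finally show ?thesis unfolding occ_def sum_product .
qed

lemma common_eq_card: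
  "common m X u v = real (card (attributes_of m X u \<inter> attributes_of m X v))"
proof -
  have "attributes_of m X u \<inter> attributes_of m X v = {..<m} \<inter> {w. X (u, w) \<and> X (v, w)}"
    by (auto simp: attributes_of_def)
  then show ?thesis
    by (simp add: common_def flip: of_bool_conj)
qed

text \<open>This rests on integrality: \<open>k * (k - 1)\<close> is negative for reals strictly
  between 0 and 1.\<close>

lemma common_mult_pred_nonneg: "0 \<le> common m X u v * (common m X u v - 1)"
  by (cases "card (attributes_of m X u \<inter> attributes_of m X v)") (simp_all add: common_eq_card)

section \<open>Comparing adjacency with the number of common attributes\<close>

lemma verts_intersection_graph [simp]: "verts (intersection_graph n m X) = {..<n}"
  by (simp add: intersection_graph_def)

lemma edge_intersection_graph_iff:
  "{u, v} \<in> edges (intersection_graph n m X) \<longleftrightarrow>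
     u < n \<and> v < n \<and> u \<noteq> v \<and> attributes_of m X u \<inter> attributes_of m X v \<noteq> {}"
  by (auto simp: intersection_graph_def doubleton_eq_iff)

lemma fin_graph_intersection_graph: "fin_graph (intersection_graph n m X)"
  by unfold_locales (auto simp: intersection_graph_def)

text \<open>For a natural number \<open>k\<close>, the indicator of \<open>k > 0\<close> is at most
  \<open>k\<close> and at least \<open>k - k * (k - 1) = 1 - (k - 1)^2\<close>. Thus
  \<open>k * (k - 1)\<close> pays for forgetting multiplicities.\<close>

lemma adj_bounds:
  fixes n m X u v
  defines "a \<equiv> of_bool ({u, v} \<in> edges (intersection_graph n m X))"
  shows "a \<le> common m X u v"
    and "u < n \<Longrightarrow> v < n \<Longrightarrow> u \<noteq> v \<Longrightarrow>
      common m X u v - common m X u v * (common m X u v - 1) \<le> a"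
proof -
  define k where "k = card (attributes_of m X u \<inter> attributes_of m X v)"
  have fin: "finite (attributes_of m X u \<inter> attributes_of m X v)"
    by (simp add: attributes_of_def)
  have c: "common m X u v = real k"
    by (simp add: common_eq_card k_def)
  show "a \<le> common m X u v"
    using fin by (auto simp: a_def edge_intersection_graph_iff c k_def of_bool_def Suc_le_eq card_gt_0_iff)
  assume "u < n" "v < n" "u \<noteq> v"
  then have a: "a = of_bool (k > 0)"
    using fin by (auto simp: a_def edge_intersection_graph_iff k_def card_gt_0_iff)
  have "0 \<le> (real k - 1) * (real k - 1)" by simp
  then show "common m X u v - common m X u v * (common m X u v - 1) \<le> a"
    unfolding a c by (cases "k > 0") (auto simp: algebra_simps)
qed

section \<open>Elementary real inequalities\<close>

text \<open>The variables \<open>a\<close>, \<open>b\<close>, \<open>t\<close> stand for twice the number of edges inside a set, its volume and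
  the total volume; \<open>\<sigma>\<close> is the relative size of the set.\<close>

lemma ratio_bound:
  fixes a b t \<mu> \<sigma> \<delta> :: real
  assumes \<sigma>: "0 \<le> \<sigma>" "\<sigma> \<le> 1" and \<delta>: "0 \<le> \<delta>" "\<delta> \<le> 1 / 100" and \<mu>: "\<mu> > 0"
    and a: "a \<le> (\<sigma>\<^sup>2 + 10 * \<delta>) * \<mu>" and b: "(\<sigma> - 4 * \<delta>) * \<mu> \<le> b"
    and t: "(1 - 4 * \<delta>) * \<mu> \<le> t" "t \<le> (1 + 3 * \<delta>) * \<mu>"
  shows "a / t - (b / t)\<^sup>2 \<le> 25 * \<delta>"
proof -
  define \<rho> where "\<rho> = t / \<mu>"
  have \<rho>: "1 - 4 * \<delta> \<le> \<rho>" "\<rho> \<le> 1 + 3 * \<delta>"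
    using t \<mu> by (simp_all add: \<rho>_def field_simps)
  then have \<rho>_lower: "96 / 100 \<le> \<rho>" using \<delta> by linarith
  have \<rho>_upper: "\<rho> \<le> 103 / 100" using \<rho>(2) \<delta> by linarith
  define x where "x = b / \<mu>"
  have x: "\<sigma> - 4 * \<delta> \<le> x" using b \<mu> by (simp add: x_def field_simps)
  have "t > 0" using \<rho>_lower \<mu> by (simp add: \<rho>_def field_simps)
  have "a / \<mu> \<le> \<sigma>\<^sup>2 + 10 * \<delta>" using a \<mu> by (simp add: field_simps)
  then have "\<rho> * (a / \<mu>) \<le> \<rho> * (\<sigma>\<^sup>2 + 10 * \<delta>)"
    using \<rho>_lower by (intro mult_left_mono) auto
  \<comment> \<open>As \<open>\<sigma> - 4 * \<delta>\<close> may be negative, the bound on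
    \<open>x\<close> cannot simply be squared; the tangent line
    \<open>2 * \<sigma> * x - \<sigma>^2\<close> of the square is used instead.\<close>
  moreover have "\<sigma>\<^sup>2 - 8 * \<delta> \<le> x\<^sup>2"
  proof -
    have "\<sigma> * (\<sigma> - 4 * \<delta>) \<le> \<sigma> * x" using x \<sigma> by (intro mult_left_mono) auto
    moreover have "\<sigma> * \<delta> \<le> 1 * \<delta>" using \<sigma> \<delta> by (intro mult_right_mono) auto
    moreover have "0 \<le> (x - \<sigma>)\<^sup>2" by simp
    ultimately show ?thesis by (simp add: power2_eq_square algebra_simps)
  qed
  moreover have "(\<rho> - 1) * \<sigma>\<^sup>2 \<le> 3 * \<delta> * 1"
  proof -
    have "(\<rho> - 1) * \<sigma>\<^sup>2 \<le> 3 * \<delta> * \<sigma>\<^sup>2" using \<rho>(2) by (intro mult_right_mono) auto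
    also have "\<dots> \<le> 3 * \<delta> * 1" using \<sigma> \<delta> by (intro mult_left_mono power_le_one) auto
    finally show ?thesis .
  qed
  moreover have "\<rho> * \<delta> \<le> 103 / 100 * \<delta>" using \<rho>_upper \<delta> by (intro mult_right_mono) auto
  \<comment> \<open>The contributions are 3 from \<open>\<rho> - 1\<close>, 10.3 from
    \<open>10 * \<rho> * \<delta>\<close> and 8 from \<open>x\<close>. Dividing by
    \<open>\<rho>^2\<close> is then affordable, since
    \<open>25 * (96/100)^2 = 23.04\<close>.\<close>
  ultimately have "\<rho> * (a / \<mu>) - x\<^sup>2 \<le> 22 * \<delta>"
    using \<delta> by (simp add: algebra_simps)
  also have "\<dots> \<le> 25 * \<delta> * (96 / 100)\<^sup>2" using \<delta> by (simp add: power2_eq_square)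
  also have "\<dots> \<le> 25 * \<delta> * \<rho>\<^sup>2"
    using \<rho>_lower \<delta> by (intro mult_left_mono power_mono) auto
  finally have "(\<rho> * (a / \<mu>) - x\<^sup>2) / \<rho>\<^sup>2 \<le> 25 * \<delta>"
    using \<rho>_lower by (simp add: field_simps)
  moreover have "a / t - (b / t)\<^sup>2 = (\<rho> * (a / \<mu>) - x\<^sup>2) / \<rho>\<^sup>2"
    using \<open>t > 0\<close> \<mu> by (simp add: \<rho>_def x_def field_simps power2_eq_square)
  ultimately show ?thesis by simp
qed

text \<open>Cauchy-Schwarz: a relative root mean square of \<open>\<epsilon>\<close> bounds the
  relative mean absolute value by \<open>\<epsilon>\<close>.\<close>

lemma sum_abs_le_of_sum_squares:
  fixes f :: "'a \<Rightarrow> real"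
  assumes "(\<Sum>i\<in>A. (f i)\<^sup>2) \<le> \<epsilon>\<^sup>2 * (real (card A) * c\<^sup>2)" "0 \<le> \<epsilon>" "0 \<le> c"
  shows "(\<Sum>i\<in>A. \<bar>f i\<bar>) \<le> \<epsilon> * (real (card A) * c)"
proof (rule power2_le_imp_le)
  have "(\<Sum>i\<in>A. \<bar>f i\<bar>)\<^sup>2 \<le> (\<Sum>i\<in>A. \<bar>f i\<bar>\<^sup>2) * real (card A)"
    by (rule sum_squared_le_sum_of_squares)
  also have "\<dots> \<le> \<epsilon>\<^sup>2 * (real (card A) * c\<^sup>2) * real (card A)"
    using assms by (intro mult_right_mono) auto
  finally show "(\<Sum>i\<in>A. \<bar>f i\<bar>)\<^sup>2 \<le> (\<epsilon> * (real (card A) * c))\<^sup>2"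
    by (simp add: power_mult_distrib power2_eq_square mult_ac)
qed (use assms in auto)

section \<open>Deterministic bounds for a typical assignment\<close>

text \<open>Here \<epsilon> is the relative mean square deviation of both degree sequences of the
  incidence table, and also sets the threshold beyond which an attribute is crowded for
  \<open>S\<close>. The fraction lost to repeated common attributes is \<theta>. The condition
  \<open>\<epsilon>_lower\<close> makes diagonal terms negligible.\<close>

locale typical_assignment =
  fixes n m :: nat and p \<epsilon> \<theta> :: real and X :: "nat \<times> nat \<Rightarrow> bool"
  assumes n_pos: "0 < n" and m_pos: "0 < m" and p_pos: "0 < p"
    and \<epsilon>_nonneg: "0 \<le> \<epsilon>" and \<epsilon>_le_1: "\<epsilon> \<le> 1" and \<epsilon>_lower: "1 \<le> \<epsilon>\<^sup>2 * (real n * p)"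
    and occ_dev: "(\<Sum>w<m. (occ X {..<n} w - real n * p)\<^sup>2) \<le> \<epsilon>\<^sup>2 * (real m * (real n * p)\<^sup>2)"
    and num_attrs_dev: "(\<Sum>v<n. (num_attrs m X v - real m * p)\<^sup>2) \<le> \<epsilon>\<^sup>2 * (real n * (real m * p)\<^sup>2)"
    and few_crowded: "S \<subseteq> {..<n} \<Longrightarrow>
      card {w \<in> {..<m}. p * real (card S) + 2 * \<epsilon> * (real n * p) < occ X S w} \<le> 5 * n"
    and few_multiple: "(\<Sum>u<n. \<Sum>v\<in>{..<n} - {u}. common m X u v * (common m X u v - 1))
      \<le> \<theta> * (real m * (real n * p)\<^sup>2)"
begin

text \<open>The leading term of the number of ordered vertex pairs, counted with
  multiplicity.\<close>

abbreviation "\<mu> \<equiv> real m * (real n * p)\<^sup>2"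
abbreviation "\<G> \<equiv> intersection_graph n m X"

sublocale fin_graph \<G> by (rule fin_graph_intersection_graph)

lemma \<mu>_pos: "\<mu> > 0"
  using n_pos m_pos p_pos by simp

lemma eps_sq_le: "\<epsilon>\<^sup>2 \<le> \<epsilon>"
  using \<epsilon>_nonneg \<epsilon>_le_1 by (simp add: power2_eq_square mult_left_le)

lemma np_ge_1: "1 \<le> real n * p"
proof -
  have "\<epsilon>\<^sup>2 * (real n * p) \<le> 1 * (real n * p)"
    using eps_sq_le \<epsilon>_le_1 p_pos by (intro mult_right_mono) auto
  then show ?thesis using \<epsilon>_lower by simp
qed

text \<open>The number of edges is dominated by the sum of squared occupancies. An attribute that is
  not crowded contributes at most the squared threshold; the few crowded ones are bounded by their
  occupancy in the whole vertex set, whose excess over \<open>n * p\<close> is paid for by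
  \<open>occ_dev\<close>.\<close>

lemma edges_inside_le:
  assumes S: "S \<subseteq> {..<n}"
  shows "2 * real (edges_inside \<G> S)
    \<le> ((real (card S) / real n)\<^sup>2 + 10 * (\<epsilon> + real n / real m)) * \<mu>"
proof -
  define s where "s = real (card S)"
  define crowded where
    "crowded w = (p * s + 2 * \<epsilon> * (real n * p) < occ X S w)" for w
  let ?b = "p * s + 2 * \<epsilon> * (real n * p)"
  let ?D = "\<lambda>w. (occ X {..<n} w - real n * p)\<^sup>2"
  have s: "0 \<le> s" "s \<le> real n"
    using card_mono[OF _ S] by (simp_all add: s_def)
  have b_nonneg: "0 \<le> ?b" using s p_pos \<epsilon>_nonneg by simp
  have "2 * real (edges_inside \<G> S) = (\<Sum>u\<in>S. \<Sum>v\<in>S. adj u v)"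
    using S by (intro edges_inside_eq_sum_adj) simp
  also have "\<dots> \<le> (\<Sum>u\<in>S. \<Sum>v\<in>S. common m X u v)"
    by (intro sum_mono adj_bounds)
  also have "\<dots> = (\<Sum>w<m. (occ X S w)\<^sup>2)"
    by (simp add: sum_common power2_eq_square)
  also have "\<dots> \<le> (\<Sum>w<m. ?b\<^sup>2 + (of_bool (crowded w) * (2 * (real n * p)\<^sup>2) + 2 * ?D w))"
  proof (rule sum_mono)
    fix w
    show "(occ X S w)\<^sup>2 \<le> ?b\<^sup>2 + (of_bool (crowded w) * (2 * (real n * p)\<^sup>2) + 2 * ?D w)"
    proof (cases "crowded w")
      case True
      have "(occ X S w)\<^sup>2 \<le> (occ X {..<n} w)\<^sup>2"
        using S by (intro power_mono occ_mono occ_nonneg) auto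
      \<comment> \<open>With \<open>y\<close> the total occupancy and \<open>c = n * p\<close>, the
        right side minus \<open>y^2\<close> is the square of \<open>y - 2 * c\<close>.\<close>
      also have "\<dots> \<le> 2 * (real n * p)\<^sup>2 + 2 * ?D w"
        using zero_le_power2[of "occ X {..<n} w - 2 * (real n * p)"]
        by (simp add: power2_eq_square algebra_simps)
      finally show ?thesis using True by (simp add: add_increasing)
    next
      case False
      then have "(occ X S w)\<^sup>2 \<le> ?b\<^sup>2"
        by (intro power_mono occ_nonneg) (simp add: crowded_def)
      then show ?thesis using False by (simp add: add_increasing2)
    qed
  qed
  also have "\<dots> = real m * ?b\<^sup>2 + real (card ({..<m} \<inter> {w. crowded w})) * (2 * (real n * p)\<^sup>2)
      + 2 * (\<Sum>w<m. ?D w)"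
    by (simp add: sum.distrib flip: sum_distrib_right sum_distrib_left)
  also have "real (card ({..<m} \<inter> {w. crowded w})) \<le> 5 * real n"
  proof -
    have "{..<m} \<inter> {w. crowded w}
        = {w \<in> {..<m}. p * real (card S) + 2 * \<epsilon> * (real n * p) < occ X S w}"
      by (auto simp: crowded_def s_def)
    then show ?thesis using few_crowded[OF S] by simp
  qed
  also have "(\<Sum>w<m. ?D w) \<le> \<epsilon> * \<mu>"
  proof -
    have "(\<Sum>w<m. ?D w) \<le> \<epsilon>\<^sup>2 * \<mu>" by (rule occ_dev)
    also have "\<dots> \<le> \<epsilon> * \<mu>" using eps_sq_le by (intro mult_right_mono) auto
    finally show ?thesis .
  qed
  also have "?b\<^sup>2 \<le> (real n * p)\<^sup>2 * ((s / real n)\<^sup>2 + 8 * \<epsilon>)"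
  proof -
    have "?b = real n * p * (s / real n + 2 * \<epsilon>)"
      using n_pos by (simp add: field_simps)
    then have "?b\<^sup>2 = (real n * p)\<^sup>2 * (s / real n + 2 * \<epsilon>)\<^sup>2"
      by (simp only: power_mult_distrib)
    also have "(s / real n + 2 * \<epsilon>)\<^sup>2 \<le> (s / real n)\<^sup>2 + 8 * \<epsilon>"
    proof -
      have "s / real n * \<epsilon> \<le> 1 * \<epsilon>"
        using s n_pos \<epsilon>_nonneg by (intro mult_right_mono) auto
      moreover have "(s / real n + 2 * \<epsilon>)\<^sup>2 = (s / real n)\<^sup>2 + 4 * (s / real n * \<epsilon>) + 4 * \<epsilon>\<^sup>2"
        by (simp add: power2_eq_square algebra_simps)
      ultimately show ?thesis using eps_sq_le by linarith
    qed
    finally show ?thesis by (simp add: mult_left_mono)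
  qed
  \<comment> \<open>The coefficient of \<epsilon> is 8 from the threshold plus 2 from the
    deviations; the crowded attributes give \<open>10 * n / m\<close> relative to \<mu>.\<close>
  also have "real m * ((real n * p)\<^sup>2 * ((s / real n)\<^sup>2 + 8 * \<epsilon>)) + 5 * real n * (2 * (real n * p)\<^sup>2)
      + 2 * (\<epsilon> * \<mu>) = ((s / real n)\<^sup>2 + 10 * (\<epsilon> + real n / real m)) * \<mu>"
    using m_pos by (simp add: field_simps)
  finally show ?thesis by (simp add: s_def mult_left_mono mult_right_mono)
qed

text \<open>Counting by vertices, the deviation over \<open>S\<close> is at most the total absolute
  deviation over all vertices. This is uniform in \<open>S\<close> without a union bound.\<close>

lemma sum_occ_bounds:
  assumes S: "S \<subseteq> {..<n}"
  shows "\<bar>(\<Sum>w<m. occ X S w) - real (card S) * (real m * p)\<bar> \<le> \<epsilon> * (real n * (real m * p))"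
proof -
  have "\<bar>(\<Sum>w<m. occ X S w) - real (card S) * (real m * p)\<bar>
      = \<bar>\<Sum>v\<in>S. num_attrs m X v - real m * p\<bar>"
    by (simp add: sum_subtractf flip: sum_num_attrs)
  also have "\<dots> \<le> (\<Sum>v\<in>S. \<bar>num_attrs m X v - real m * p\<bar>)"
    by (rule sum_abs)
  also have "\<dots> \<le> (\<Sum>v<n. \<bar>num_attrs m X v - real m * p\<bar>)"
    using S by (intro sum_mono2) auto
  also have "\<dots> \<le> \<epsilon> * (real (card {..<n}) * (real m * p))"
    using num_attrs_dev \<epsilon>_nonneg p_pos by (intro sum_abs_le_of_sum_squares) auto
  finally show ?thesis by simp
qed

text \<open>Since the occupancy of \<open>S\<close> is at most
  \<open>n * p + \<bar>?d w\<bar>\<close>, the sum splits into a first moment, handled by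
  Cauchy-Schwarz, and a second moment of the deviations. Each costs
  \<open>\<epsilon> * \<mu>\<close>.\<close>

lemma sum_occ_deviation:
  assumes S: "S \<subseteq> {..<n}"
  shows "\<bar>\<Sum>w<m. occ X S w * (occ X {..<n} w - real n * p)\<bar> \<le> 2 * \<epsilon> * \<mu>"
proof -
  let ?d = "\<lambda>w. occ X {..<n} w - real n * p"
  have "\<bar>\<Sum>w<m. occ X S w * ?d w\<bar> \<le> (\<Sum>w<m. \<bar>occ X S w * ?d w\<bar>)"
    by (rule sum_abs)
  also have "\<dots> \<le> (\<Sum>w<m. real n * p * \<bar>?d w\<bar> + (?d w)\<^sup>2)"
  proof (rule sum_mono)
    fix w
    have "\<bar>occ X S w * ?d w\<bar> \<le> (real n * p + \<bar>?d w\<bar>) * \<bar>?d w\<bar>"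
      unfolding abs_mult
    proof (rule mult_right_mono)
      have "occ X S w \<le> occ X {..<n} w" using S by (intro occ_mono) auto
      then show "\<bar>occ X S w\<bar> \<le> real n * p + \<bar>?d w\<bar>"
        using occ_nonneg[of X S w] by linarith
    qed simp
    then show "\<bar>occ X S w * ?d w\<bar> \<le> real n * p * \<bar>?d w\<bar> + (?d w)\<^sup>2"
      by (simp add: distrib_right power2_eq_square flip: abs_mult)
  qed
  also have "\<dots> = real n * p * (\<Sum>w<m. \<bar>?d w\<bar>) + (\<Sum>w<m. (?d w)\<^sup>2)"
    by (simp add: sum.distrib sum_distrib_left)
  also have "\<dots> \<le> real n * p * (\<epsilon> * (real (card {..<m}) * (real n * p))) + \<epsilon> * \<mu>"
  proof (intro add_mono mult_left_mono)
    show "(\<Sum>w<m. \<bar>?d w\<bar>) \<le> \<epsilon> * (real (card {..<m}) * (real n * p))"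
      using occ_dev \<epsilon>_nonneg p_pos by (intro sum_abs_le_of_sum_squares) auto
    have "\<epsilon>\<^sup>2 * \<mu> \<le> \<epsilon> * \<mu>" using eps_sq_le by (intro mult_right_mono) auto
    then show "(\<Sum>w<m. (?d w)\<^sup>2) \<le> \<epsilon> * \<mu>" using occ_dev by linarith
  qed (use p_pos in auto)
  finally show ?thesis by (simp add: power2_eq_square mult_ac)
qed

lemma vol_le: "real (vol \<G> {..<n}) \<le> (1 + 3 * \<epsilon>) * \<mu>"
proof -
  let ?V = "{..<n}"
  have "real (vol \<G> ?V) \<le> (\<Sum>u<n. \<Sum>v<n. common m X u v)"
    using vol_eq_sum_adj[of "{..<n}"] by (simp only: verts_intersection_graph subset_refl)
      (intro sum_mono adj_bounds)
  also have "\<dots> = real n * p * (\<Sum>w<m. occ X ?V w)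
      + (\<Sum>w<m. occ X ?V w * (occ X ?V w - real n * p))"
    by (simp add: sum_common algebra_simps sum_subtractf sum_distrib_left)
  also have "\<dots> \<le> real n * p * ((1 + \<epsilon>) * (real n * (real m * p))) + 2 * \<epsilon> * \<mu>"
  proof (intro add_mono mult_left_mono)
    show "(\<Sum>w<m. occ X ?V w) \<le> (1 + \<epsilon>) * (real n * (real m * p))"
      using sum_occ_bounds[of ?V] by (simp add: algebra_simps)
    show "(\<Sum>w<m. occ X ?V w * (occ X ?V w - real n * p)) \<le> 2 * \<epsilon> * \<mu>"
      using sum_occ_deviation[of ?V] by simp
  qed (use p_pos in auto)
  finally show ?thesis by (simp add: power2_eq_square algebra_simps)
qed

text \<open>Count the pairs in \<open>S\<close> times the vertex set with multiplicity, then remove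
  the diagonal and the repeated common attributes. The loss in \<epsilon> is 2 from
  \<open>sum_occ_deviation\<close>, 1 from \<open>sum_occ_bounds\<close> and 1 from the
  diagonal.\<close>

lemma vol_ge:
  assumes S: "S \<subseteq> {..<n}"
  shows "(real (card S) / real n - 4 * (\<epsilon> + \<theta>)) * \<mu> \<le> real (vol \<G> S)"
proof -
  let ?V = "{..<n}" and ?c = "common m X"
  define s where "s = real (card S)"
  have s: "0 \<le> s" "s \<le> real n"
    using card_mono[OF _ S] by (simp_all add: s_def)
  have "(\<Sum>w<m. occ X S w * occ X ?V w) - (\<Sum>w<m. occ X S w) - \<theta> * \<mu>
      \<le> (\<Sum>u\<in>S. \<Sum>v<n. ?c u v) - (\<Sum>u\<in>S. ?c u u)
        - (\<Sum>u\<in>S. \<Sum>v\<in>?V - {u}. ?c u v * (?c u v - 1))"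
  proof -
    have "(\<Sum>u\<in>S. \<Sum>v\<in>?V - {u}. ?c u v * (?c u v - 1))
        \<le> (\<Sum>u<n. \<Sum>v\<in>?V - {u}. ?c u v * (?c u v - 1))"
      using S by (intro sum_mono2 sum_nonneg common_mult_pred_nonneg) auto
    moreover have "(\<Sum>u\<in>S. ?c u u) = (\<Sum>w<m. occ X S w)"
      by (subst sum_num_attrs[symmetric]) (simp add: common_def num_attrs_def flip: of_bool_conj)
    ultimately show ?thesis using few_multiple by (simp add: sum_common)
  qed
  also have "\<dots> = (\<Sum>u\<in>S. \<Sum>v\<in>?V - {u}. ?c u v - ?c u v * (?c u v - 1))"
  proof -
    have "(\<Sum>v<n. ?c u v) - ?c u u = (\<Sum>v\<in>?V - {u}. ?c u v)" if "u \<in> S" for u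
      using S that by (simp add: sum_diff1 subset_iff)
    then have "(\<Sum>u\<in>S. \<Sum>v<n. ?c u v) - (\<Sum>u\<in>S. ?c u u) = (\<Sum>u\<in>S. \<Sum>v\<in>?V - {u}. ?c u v)"
      by (simp flip: sum_subtractf cong: sum.cong)
    then show ?thesis by (simp add: sum_subtractf)
  qed
  also have "\<dots> \<le> (\<Sum>u\<in>S. \<Sum>v\<in>?V - {u}. adj u v)"
    using S by (intro sum_mono adj_bounds) auto
  also have "\<dots> \<le> (\<Sum>u\<in>S. \<Sum>v<n. adj u v)"
    by (intro sum_mono sum_mono2) auto
  also have "\<dots> = real (vol \<G> S)"
    using S by (simp add: vol_eq_sum_adj)
  finally have "(\<Sum>w<m. occ X S w * occ X ?V w) - (\<Sum>w<m. occ X S w) - \<theta> * \<mu> \<le> real (vol \<G> S)" .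
  \<comment> \<open>Removing the diagonal turns the factor \<open>n * p\<close> into
    \<open>n * p - 1\<close>, nonnegative by \<open>np_ge_1\<close>, so a lower bound on the sum may
    be multiplied by it.\<close>
  moreover have "(\<Sum>w<m. occ X S w * occ X ?V w) - (\<Sum>w<m. occ X S w)
      = (real n * p - 1) * (\<Sum>w<m. occ X S w)
        + (\<Sum>w<m. occ X S w * (occ X ?V w - real n * p))"
    by (simp add: algebra_simps sum_subtractf sum_distrib_left)
  moreover have "(real n * p - 1) * (\<Sum>w<m. occ X S w)
      \<ge> (real n * p - 1) * (s * (real m * p) - \<epsilon> * (real n * (real m * p)))"
    using sum_occ_bounds[OF S] np_ge_1 by (intro mult_left_mono) (auto simp: s_def)
  moreover have "(\<Sum>w<m. occ X S w * (occ X ?V w - real n * p)) \<ge> - (2 * \<epsilon> * \<mu>)"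
    using sum_occ_deviation[OF S] by simp
  moreover have "(real n * p - 1) * (s * (real m * p) - \<epsilon> * (real n * (real m * p)))
      \<ge> s / real n * \<mu> - 2 * \<epsilon> * \<mu>"
  proof -
    have "s * (real m * p) \<le> real n * (real m * p)"
      using s p_pos by (intro mult_right_mono) auto
    also have "\<dots> \<le> \<epsilon> * \<mu>"
    proof -
      have "1 \<le> \<epsilon> * (real n * p)"
        using \<epsilon>_lower mult_right_mono[OF eps_sq_le, of "real n * p"] p_pos by simp
      then have "1 * (real n * (real m * p)) \<le> \<epsilon> * (real n * p) * (real n * (real m * p))"
        using p_pos by (intro mult_right_mono) auto
      then show ?thesis by (simp add: power2_eq_square mult_ac)
    qed
    finally have "s * (real m * p) \<le> \<epsilon> * \<mu>" .
    moreover have "0 \<le> \<epsilon> * (real n * (real m * p))" using \<epsilon>_nonneg p_pos by simp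
    moreover have "s / real n * \<mu> = real n * p * (s * (real m * p))"
      using n_pos by (simp add: field_simps power2_eq_square)
    ultimately show ?thesis
      using n_pos by (simp add: algebra_simps power2_eq_square)
  qed
  ultimately have "s / real n * \<mu> - 4 * \<epsilon> * \<mu> - \<theta> * \<mu> \<le> real (vol \<G> S)"
    by linarith
  \<comment> \<open>The sign comes from \<open>few_multiple\<close>, whose left side is nonnegative;
    it allows \<theta> to be weakened to \<open>4 * \<theta>\<close>.\<close>
  moreover have "0 \<le> \<theta> * \<mu>"
    using few_multiple by (rule order_trans[rotated]) (intro sum_nonneg common_mult_pred_nonneg)
  ultimately show ?thesis by (simp add: s_def algebra_simps)
qed

text \<open>The total volume is at least \<open>(1 - 4 * \<delta>) * \<mu>\<close>, which is
  positive, so edges exist. The constant 100 is the factor 4 from partitions times the 25 of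
  \<open>ratio_bound\<close>.\<close>

lemma abs_modularity_typical:
  assumes \<delta>: "\<epsilon> + real n / real m + \<theta> \<le> 1 / 100" and \<theta>: "0 \<le> \<theta>"
  shows "edges \<G> \<noteq> {} \<and> \<bar>modularity \<G>\<bar> \<le> 100 * (\<epsilon> + real n / real m + \<theta>)"
proof -
  define \<delta> where "\<delta> = \<epsilon> + real n / real m + \<theta>"
  have parts: "0 \<le> \<epsilon>" "0 \<le> real n / real m" "0 \<le> \<theta>"
    using \<epsilon>_nonneg \<theta> by auto
  have \<delta>_bounds: "0 \<le> \<delta>" "\<delta> \<le> 1 / 100" using parts \<delta> by (auto simp: \<delta>_def)
  have mono: "x * \<mu> \<le> y * \<mu>" if "x \<le> y" for x y
    using that \<mu>_pos by (intro mult_right_mono) auto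
  have vol_total: "(1 - 4 * \<delta>) * \<mu> \<le> real (vol \<G> {..<n})" "real (vol \<G> {..<n}) \<le> (1 + 3 * \<delta>) * \<mu>"
    using vol_ge[of "{..<n}"] mono[of "1 - 4 * \<delta>" "1 - 4 * (\<epsilon> + \<theta>)"] vol_le
      mono[of "1 + 3 * \<epsilon>" "1 + 3 * \<delta>"] n_pos parts by (auto simp: \<delta>_def)
  have "0 < (1 - 4 * \<delta>) * \<mu>" using \<delta>_bounds by (intro mult_pos_pos \<mu>_pos) auto
  then have vol_pos: "real (vol \<G> {..<n}) > 0" using vol_total by linarith
  then have "card (edges \<G>) \<noteq> 0" using vol_verts by auto
  then have ne: "edges \<G> \<noteq> {}" by auto
  have "\<bar>modularity \<G>\<bar> \<le> 4 * (25 * \<delta>)"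
  proof (rule abs_modularity_le[OF ne])
    fix S assume "S \<subseteq> verts \<G>"
    then have S: "S \<subseteq> {..<n}" by simp
    have "real (card S) \<le> real n" using card_mono[OF _ S] by simp
    have "real (edges_inside \<G> S) / real (card (edges \<G>))
        - (real (vol \<G> S) / real (vol \<G> (verts \<G>)))\<^sup>2
      = 2 * real (edges_inside \<G> S) / real (vol \<G> {..<n})
        - (real (vol \<G> S) / real (vol \<G> {..<n}))\<^sup>2"
      using vol_verts by simp
    also have "\<dots> \<le> 25 * \<delta>"
    proof (rule ratio_bound[where \<mu> = \<mu> and \<sigma> = "real (card S) / real n"])
      show "2 * real (edges_inside \<G> S) \<le> ((real (card S) / real n)\<^sup>2 + 10 * \<delta>) * \<mu>"
        by (rule order_trans[OF edges_inside_le[OF S] mono]) (use parts in \<open>simp add: \<delta>_def\<close>)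
      show "(real (card S) / real n - 4 * \<delta>) * \<mu> \<le> real (vol \<G> S)"
        by (rule order_trans[OF mono vol_ge[OF S]]) (use parts in \<open>simp add: \<delta>_def\<close>)
    qed (use \<delta>_bounds \<mu>_pos vol_total n_pos \<open>real (card S) \<le> real n\<close> in auto)
    finally show "real (edges_inside \<G> S) / real (card (edges \<G>))
        - (real (vol \<G> S) / real (vol \<G> (verts \<G>)))\<^sup>2 \<le> 25 * \<delta>" .
  qed
  then show ?thesis using ne by (simp add: \<delta>_def)
qed

end

section \<open>Probability estimates\<close>

locale random_assignment =
  fixes n m :: nat and p :: real
  assumes p_bounds: "0 \<le> p" "p \<le> 1"
begin

abbreviation "index \<equiv> {..<n} \<times> {..<m}"
abbreviation "assignment \<equiv> Pi_pmf index False (\<lambda>_. bernoulli_pmf p)"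
abbreviation "E f \<equiv> measure_pmf.expectation assignment f"
abbreviation "prob A \<equiv> measure_pmf.prob assignment A"

text \<open>The assignment has finite support, so linearity and monotonicity of expectation carry no
  side conditions.\<close>

lemma integrable_assignment [simp]:
  fixes f :: "(nat \<times> nat \<Rightarrow> bool) \<Rightarrow> real"
  shows "integrable assignment f"
  by (intro integrable_measure_pmf_finite) (simp add: set_Pi_pmf finite_PiE_dflt)

lemma expectation_sum:
  fixes f :: "'i \<Rightarrow> (nat \<times> nat \<Rightarrow> bool) \<Rightarrow> real"
  shows "E (\<lambda>X. \<Sum>i\<in>I. f i X) = (\<Sum>i\<in>I. E (f i))"
  by (rule Bochner_Integration.integral_sum) simp

lemma expectation_mono:
  fixes f g :: "(nat \<times> nat \<Rightarrow> bool) \<Rightarrow> real"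
  shows "(\<And>X. f X \<le> g X) \<Longrightarrow> E f \<le> E g"
  by (rule integral_mono) auto

lemma prob_gt_le:
  fixes f :: "(nat \<times> nat \<Rightarrow> bool) \<Rightarrow> real"
  assumes "\<And>X. 0 \<le> f X" "E f \<le> c" "0 < t"
  shows "prob {X. t < f X} \<le> c / t"
proof -
  have "prob {X. t < f X} \<le> prob {X \<in> space assignment. t \<le> f X}"
    by (intro measure_pmf.finite_measure_mono) auto
  also have "\<dots> \<le> E f / t"
    using assms by (intro integral_Markov_inequality_measure[where A = "{}"]) auto
  also have "\<dots> \<le> c / t" using assms by (intro divide_right_mono) auto
  finally show ?thesis .
qed

text \<open>Independence of the entries; factors outside \<open>B\<close> are set to 1 so that the
  product runs over the whole table.\<close>

lemma expectation_prod:
  fixes f :: "bool \<Rightarrow> real"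
  assumes B: "B \<subseteq> index" and f: "\<And>b. 0 \<le> f b"
  shows "E (\<lambda>X. \<Prod>z\<in>B. f (X z)) = (p * f True + (1 - p) * f False) ^ card B"
proof -
  have Int: "index \<inter> B = B" using B by auto
  define g where "g z b = (if z \<in> B then f b else 1)" for z b
  have "E (\<lambda>X. \<Prod>z\<in>B. f (X z)) = E (\<lambda>X. \<Prod>z\<in>index. g z (X z))"
    by (simp add: g_def Int flip: prod.inter_restrict)
  also have "\<dots> = (\<Prod>z\<in>index. measure_pmf.expectation (bernoulli_pmf p) (g z))"
    using f by (intro expectation_prod_Pi_pmf) (auto simp: g_def intro: integrable_measure_pmf_finite)
  also have "\<dots> = (\<Prod>z\<in>index. if z \<in> B then p * f True + (1 - p) * f False else 1)"
    using p_bounds by (intro prod.cong refl) (simp add: g_def algebra_simps)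
  also have "\<dots> = (p * f True + (1 - p) * f False) ^ card B"
    by (simp add: Int flip: prod.inter_restrict)
  finally show ?thesis .
qed

lemma expectation_all: "B \<subseteq> index \<Longrightarrow> E (\<lambda>X. \<Prod>z\<in>B. of_bool (X z)) = p ^ card B"
  by (subst expectation_prod) auto

text \<open>The binomial variance \<open>k * p * (1 - p)\<close>, computed from the pairwise
  products.\<close>

lemma expectation_sum_dev:
  assumes B: "B \<subseteq> index"
  shows "E (\<lambda>X. ((\<Sum>z\<in>B. of_bool (X z)) - real (card B) * p)\<^sup>2) \<le> real (card B) * p"
proof -
  let ?x = "\<lambda>X z. of_bool (X z) :: real"
  define k where "k = real (card B)"
  have fin: "finite B" using B finite_subset by blast
  have one: "E (\<lambda>X. ?x X z) = p" if "z \<in> B" for z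
    using that B expectation_all[of "{z}"] by auto
  have two: "E (\<lambda>X. ?x X z * ?x X z') = p\<^sup>2 + (if z = z' then p - p\<^sup>2 else 0)"
    if "z \<in> B" "z' \<in> B" for z z'
  proof (cases "z = z'")
    case True
    then show ?thesis using one[OF that(1)] by (simp flip: of_bool_conj)
  next
    case False
    then show ?thesis using that B expectation_all[of "{z, z'}"] by (auto simp: power2_eq_square)
  qed
  have "E (\<lambda>X. ((\<Sum>z\<in>B. ?x X z) - k * p)\<^sup>2)
      = E (\<lambda>X. (\<Sum>z\<in>B. \<Sum>z'\<in>B. ?x X z * ?x X z') - 2 * k * p * (\<Sum>z\<in>B. ?x X z) + (k * p)\<^sup>2)"
    by (simp add: power2_diff algebra_simps power2_eq_square sum_product)
  also have "\<dots> = (\<Sum>z\<in>B. \<Sum>z'\<in>B. E (\<lambda>X. ?x X z * ?x X z'))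
      - 2 * k * p * (\<Sum>z\<in>B. E (\<lambda>X. ?x X z)) + (k * p)\<^sup>2"
    by (simp add: expectation_sum)
  also have "\<dots> = k * (p - p\<^sup>2)"
    using fin by (simp add: one two sum.distrib power2_eq_square algebra_simps k_def)
  also have "\<dots> \<le> k * p" by (simp add: k_def mult_left_mono)
  finally show ?thesis by (simp add: k_def)
qed

section \<open>Markov bounds for squared deviations and repeated common attributes\<close>

lemma prob_occ_dev:
  assumes "0 < t"
  shows "prob {X. t < (\<Sum>w<m. (occ X {..<n} w - real n * p)\<^sup>2)} \<le> real m * (real n * p) / t"
proof (rule prob_gt_le)
  have "E (\<lambda>X. (occ X {..<n} w - real n * p)\<^sup>2) \<le> real n * p" if "w < m" for w
  proof -
    have "occ X {..<n} w = (\<Sum>z\<in>(\<lambda>v. (v, w)) ` {..<n}. of_bool (X z))" for X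
      by (simp add: occ_def sum.reindex inj_on_def del: sum_of_bool_eq)
    moreover have "card ((\<lambda>v. (v, w)) ` {..<n}) = n" by (simp add: card_image inj_on_def)
    ultimately show ?thesis
      using expectation_sum_dev[of "(\<lambda>v. (v, w)) ` {..<n}"] that by auto
  qed
  then have "(\<Sum>w<m. E (\<lambda>X. (occ X {..<n} w - real n * p)\<^sup>2)) \<le> (\<Sum>w<m. real n * p)"
    by (intro sum_mono) auto
  then show "E (\<lambda>X. \<Sum>w<m. (occ X {..<n} w - real n * p)\<^sup>2) \<le> real m * (real n * p)"
    by (simp add: expectation_sum)
qed (use assms in \<open>auto intro: sum_nonneg\<close>)

lemma prob_num_attrs_dev:
  assumes "0 < t"
  shows "prob {X. t < (\<Sum>v<n. (num_attrs m X v - real m * p)\<^sup>2)} \<le> real n * (real m * p) / t"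
proof (rule prob_gt_le)
  have "E (\<lambda>X. (num_attrs m X v - real m * p)\<^sup>2) \<le> real m * p" if "v < n" for v
  proof -
    have "num_attrs m X v = (\<Sum>z\<in>(\<lambda>w. (v, w)) ` {..<m}. of_bool (X z))" for X
      by (simp add: num_attrs_def sum.reindex inj_on_def del: sum_of_bool_eq)
    moreover have "card ((\<lambda>w. (v, w)) ` {..<m}) = m" by (simp add: card_image inj_on_def)
    ultimately show ?thesis
      using expectation_sum_dev[of "(\<lambda>w. (v, w)) ` {..<m}"] that by auto
  qed
  then have "(\<Sum>v<n. E (\<lambda>X. (num_attrs m X v - real m * p)\<^sup>2)) \<le> (\<Sum>v<n. real m * p)"
    by (intro sum_mono) auto
  then show "E (\<lambda>X. \<Sum>v<n. (num_attrs m X v - real m * p)\<^sup>2) \<le> real n * (real m * p)"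
    by (simp add: expectation_sum)
qed (use assms in \<open>auto intro: sum_nonneg\<close>)

text \<open>The product counts ordered pairs of distinct common attributes. Each such pair requires
  four different entries of the table to hold, an event of probability \<open>p ^ 4\<close>.\<close>

lemma expectation_multiple:
  assumes uv: "u < n" "v < n" "u \<noteq> v"
  shows "E (\<lambda>X. common m X u v * (common m X u v - 1)) \<le> (real m)\<^sup>2 * p ^ 4"
proof -
  let ?x = "\<lambda>X v w. of_bool (X (v, w)) :: real"
  let ?y = "\<lambda>X w. ?x X u w * ?x X v w"
  have pair: "E (\<lambda>X. ?y X w * ?y X w') = p ^ 4" if "w < m" "w' < m" "w \<noteq> w'" for w w'
  proof -
    have "?y X w * ?y X w' = (\<Prod>z\<in>{(u, w), (v, w), (u, w'), (v, w')}. of_bool (X z))" for X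
      using uv that by simp
    moreover have "card {(u, w), (v, w), (u, w'), (v, w')} = 4" using uv that by simp
    ultimately show ?thesis
      using expectation_all[of "{(u, w), (v, w), (u, w'), (v, w')}"] uv that by (simp add: mult.assoc power4_eq_xxxx)
  qed
  have "common m X u v * (common m X u v - 1) = (\<Sum>w<m. \<Sum>w'\<in>{..<m} - {w}. ?y X w * ?y X w')" for X
  proof -
    have "(\<Sum>w<m. \<Sum>w'\<in>{..<m} - {w}. ?y X w * ?y X w')
        = (\<Sum>w<m. (\<Sum>w'<m. ?y X w * ?y X w') - ?y X w * ?y X w)"
      by (intro sum.cong refl) (simp add: sum_diff1)
    also have "\<dots> = (\<Sum>w<m. ?y X w) * (\<Sum>w<m. ?y X w) - (\<Sum>w<m. ?y X w)"
    proof -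
      have "?y X w * ?y X w = ?y X w" for w by simp
      then show ?thesis by (simp only: sum_subtractf sum_product)
    qed
    finally show ?thesis by (simp add: common_def algebra_simps)
  qed
  then have "E (\<lambda>X. common m X u v * (common m X u v - 1)) = (\<Sum>w<m. \<Sum>w'\<in>{..<m} - {w}. p ^ 4)"
    using pair by (simp add: expectation_sum)
  also have "\<dots> \<le> (\<Sum>w<m. \<Sum>w'<m. p ^ 4)"
    using p_bounds by (intro sum_mono sum_mono2) auto
  also have "\<dots> = (real m)\<^sup>2 * p ^ 4" by (simp add: power2_eq_square)
  finally show ?thesis .
qed

lemma prob_multiple:
  assumes "0 < t"
  shows "prob {X. t < (\<Sum>u<n. \<Sum>v\<in>{..<n} - {u}. common m X u v * (common m X u v - 1))}
    \<le> (real n)\<^sup>2 * ((real m)\<^sup>2 * p ^ 4) / t"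
proof (rule prob_gt_le)
  have "(\<Sum>u<n. \<Sum>v\<in>{..<n} - {u}. E (\<lambda>X. common m X u v * (common m X u v - 1)))
      \<le> (\<Sum>u<n. \<Sum>v\<in>{..<n} - {u}. (real m)\<^sup>2 * p ^ 4)"
    by (intro sum_mono expectation_multiple) auto
  also have "\<dots> \<le> (\<Sum>u<n. \<Sum>v<n. (real m)\<^sup>2 * p ^ 4)"
    using p_bounds by (intro sum_mono sum_mono2) auto
  also have "\<dots> = (real n)\<^sup>2 * ((real m)\<^sup>2 * p ^ 4)" by (simp add: power2_eq_square)
  finally show "E (\<lambda>X. \<Sum>u<n. \<Sum>v\<in>{..<n} - {u}. common m X u v * (common m X u v - 1))
      \<le> (real n)\<^sup>2 * ((real m)\<^sup>2 * p ^ 4)"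
    by (simp add: expectation_sum)
qed (use assms in \<open>auto intro!: sum_nonneg common_mult_pred_nonneg\<close>)

section \<open>Exponential moments of occupancies\<close>

text \<open>The factors for different attributes are independent; expanding the product into monomials
  reduces this to the product formula for single entries.\<close>

lemma expectation_prod_exp_occ:
  assumes S: "S \<subseteq> {..<n}" and K: "0 \<le> K"
  shows "E (\<lambda>X. \<Prod>w<m. 1 + K * exp (\<epsilon> * occ X S w))
    = (1 + K * (1 + p * (exp \<epsilon> - 1)) ^ card S) ^ m"
proof -
  define q where "q = K * (1 + p * (exp \<epsilon> - 1)) ^ card S"
  have finS: "finite S" using S finite_subset by blast
  have "(\<Prod>w<m. 1 + K * exp (\<epsilon> * occ X S w))
      = (\<Sum>U\<in>Pow {..<m}. K ^ card U * (\<Prod>z\<in>S \<times> U. exp (\<epsilon> * of_bool (X z))))" for X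
  proof -
    have "(\<Prod>w<m. 1 + K * exp (\<epsilon> * occ X S w)) = (\<Prod>w<m. K * exp (\<epsilon> * occ X S w) + 1)"
      by (simp add: add.commute)
    also have "\<dots> = (\<Sum>U\<in>Pow {..<m}. \<Prod>w\<in>U. K * exp (\<epsilon> * occ X S w))"
      by (simp add: prod_add)
    also have "\<dots> = (\<Sum>U\<in>Pow {..<m}. K ^ card U * (\<Prod>w\<in>U. \<Prod>v\<in>S. exp (\<epsilon> * of_bool (X (v, w)))))"
      by (simp only: prod.distrib occ_def sum_distrib_left exp_sum[OF finS] prod_constant)
    also have "\<dots> = (\<Sum>U\<in>Pow {..<m}. K ^ card U * (\<Prod>z\<in>S \<times> U. exp (\<epsilon> * of_bool (X z))))"
      by (intro sum.cong refl) (subst prod.swap, simp add: prod.cartesian_product case_prod_beta)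
    finally show ?thesis .
  qed
  then have "E (\<lambda>X. \<Prod>w<m. 1 + K * exp (\<epsilon> * occ X S w))
      = (\<Sum>U\<in>Pow {..<m}. K ^ card U * E (\<lambda>X. \<Prod>z\<in>S \<times> U. exp (\<epsilon> * of_bool (X z))))"
    by (simp add: expectation_sum)
  also have "\<dots> = (\<Sum>U\<in>Pow {..<m}. \<Prod>w\<in>U. q)"
  proof (intro sum.cong refl)
    fix U assume "U \<in> Pow {..<m}"
    then have "E (\<lambda>X. \<Prod>z\<in>S \<times> U. exp (\<epsilon> * of_bool (X z)))
        = (p * exp (\<epsilon> * of_bool True) + (1 - p) * exp (\<epsilon> * of_bool False)) ^ card (S \<times> U)"
      using S by (intro expectation_prod) auto
    also have "\<dots> = ((1 + p * (exp \<epsilon> - 1)) ^ card S) ^ card U"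
      by (simp add: algebra_simps card_cartesian_product power_mult)
    finally show "K ^ card U * E (\<lambda>X. \<Prod>z\<in>S \<times> U. exp (\<epsilon> * of_bool (X z))) = (\<Prod>w\<in>U. q)"
      by (simp add: q_def power_mult_distrib)
  qed
  also have "\<dots> = (\<Prod>w<m. q + 1)" by (subst prod_add) simp_all
  finally show ?thesis by (simp add: q_def add.commute)
qed

text \<open>Two exponential bounds are nested: a Chernoff estimate with parameter \<epsilon> for
  each attribute, and Markov's inequality for the exponential of the number of crowded attributes.
  The mean of that exponential is at most \<open>exp (2 * n)\<close>, so exceeding
  \<open>exp (5 * n)\<close> is rare enough for a union bound over all \<open>S\<close>.\<close>

lemma prob_many_crowded:
  assumes S: "S \<subseteq> {..<n}" and \<epsilon>: "0 \<le> \<epsilon>" "\<epsilon> \<le> 1"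
    and rare: "real m * exp (- (\<epsilon>\<^sup>2 * (real n * p))) \<le> real n"
  shows "prob {X. 5 * n < card {w \<in> {..<m}. p * real (card S) + 2 * \<epsilon> * (real n * p) < occ X S w}}
    \<le> exp (- 3 * real n)"
proof -
  define s where "s = real (card S)"
  define b where "b = p * s + 2 * \<epsilon> * (real n * p)"
  \<comment> \<open>The factor 2 covers \<open>exp 1 - 1\<close>, so that
    \<open>1 + K * exp (\<epsilon> * occ X S w)\<close> dominates the exponential of the crowdedness
    indicator.\<close>
  define K where "K = 2 * exp (- \<epsilon> * b)"
  define N where "N X = card {w \<in> {..<m}. b < occ X S w}" for X
  have s: "0 \<le> s" "s \<le> real n" using card_mono[OF _ S] by (simp_all add: s_def)
  have "E (\<lambda>X. exp (real (N X))) \<le> E (\<lambda>X. \<Prod>w<m. 1 + K * exp (\<epsilon> * occ X S w))"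
  proof (rule expectation_mono)
    fix X
    have "real (N X) = (\<Sum>w<m. of_bool (b < occ X S w))"
      by (simp add: N_def Int_def)
    then have "exp (real (N X)) = (\<Prod>w<m. exp (of_bool (b < occ X S w)))"
      by (simp add: exp_sum del: sum_of_bool_eq)
    also have "\<dots> \<le> (\<Prod>w<m. 1 + K * exp (\<epsilon> * occ X S w))"
    proof (rule prod_mono, intro conjI)
      fix w
      show "exp (of_bool (b < occ X S w)) \<le> 1 + K * exp (\<epsilon> * occ X S w)"
      proof (cases "b < occ X S w")
        case True
        then have "\<epsilon> * b \<le> \<epsilon> * occ X S w" using \<epsilon> by (intro mult_left_mono) auto
        then have "1 \<le> exp (- \<epsilon> * b) * exp (\<epsilon> * occ X S w)"
          by (simp flip: exp_add)
        moreover have "exp (1::real) \<le> 3" by (rule exp_le)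
        ultimately show ?thesis using True by (simp add: K_def)
      next
        case False
        then show ?thesis by (simp add: K_def)
      qed
    qed simp
    finally show "exp (real (N X)) \<le> (\<Prod>w<m. 1 + K * exp (\<epsilon> * occ X S w))" .
  qed
  also have "\<dots> = (1 + K * (1 + p * (exp \<epsilon> - 1)) ^ card S) ^ m"
    using S by (intro expectation_prod_exp_occ) (auto simp: K_def)
  also have "\<dots> \<le> exp (K * (1 + p * (exp \<epsilon> - 1)) ^ card S) ^ m"
    using p_bounds \<epsilon> by (intro power_mono) (auto simp: K_def intro!: add_nonneg_nonneg mult_nonneg_nonneg)
  also have "\<dots> = exp (real m * (K * (1 + p * (exp \<epsilon> - 1)) ^ card S))"
    by (simp add: exp_of_nat_mult)
  also have "\<dots> \<le> exp (2 * real n)"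
  proof -
    have "(1 + p * (exp \<epsilon> - 1)) ^ card S \<le> exp (p * (exp \<epsilon> - 1)) ^ card S"
      using p_bounds \<epsilon> by (intro power_mono) auto
    also have "\<dots> = exp (s * (p * (exp \<epsilon> - 1)))"
      by (simp add: exp_of_nat_mult s_def)
    also have "\<dots> \<le> exp (s * (p * (\<epsilon> + \<epsilon>\<^sup>2)))"
      using exp_bound[OF \<epsilon>] p_bounds s by (simp add: mult_left_mono)
    finally have "K * (1 + p * (exp \<epsilon> - 1)) ^ card S \<le> K * exp (s * (p * (\<epsilon> + \<epsilon>\<^sup>2)))"
      by (intro mult_left_mono) (auto simp: K_def)
    \<comment> \<open>The terms linear in \<epsilon> cancel against the mean \<open>p * s\<close>
      inside \<open>b\<close>; the slack \<open>2 * \<epsilon> * n * p\<close> then outweighs the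
      quadratic term.\<close>
    also have "\<dots> = 2 * exp (\<epsilon>\<^sup>2 * (s * p) - 2 * (\<epsilon>\<^sup>2 * (real n * p)))"
      by (simp add: K_def b_def power2_eq_square algebra_simps flip: exp_add)
    also have "\<dots> \<le> 2 * exp (- (\<epsilon>\<^sup>2 * (real n * p)))"
    proof -
      have "\<epsilon>\<^sup>2 * (s * p) \<le> \<epsilon>\<^sup>2 * (real n * p)"
        using s p_bounds by (intro mult_left_mono mult_right_mono) auto
      then show ?thesis by (intro mult_left_mono iffD2[OF exp_le_cancel_iff]) linarith+
    qed
    finally have "real m * (K * (1 + p * (exp \<epsilon> - 1)) ^ card S)
        \<le> real m * (2 * exp (- (\<epsilon>\<^sup>2 * (real n * p))))"
      by (intro mult_left_mono) auto
    then show ?thesis using rare by simp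
  qed
  finally have "prob {X. exp (5 * real n) < exp (real (N X))} \<le> exp (2 * real n) / exp (5 * real n)"
    by (intro prob_gt_le) auto
  also have "\<dots> = exp (- 3 * real n)" by (simp flip: exp_diff)
  also have "{X. exp (5 * real n) < exp (real (N X))} = {X. 5 * n < N X}"
  proof -
    have "5 * real n < real (N X) \<longleftrightarrow> 5 * n < N X" for X by linarith
    then show ?thesis by simp
  qed
  finally show ?thesis by (simp add: N_def b_def s_def)
qed

text \<open>A union bound over four kinds of failure. For crowded attributes the
  \<open>2 ^ n\<close> sets cost at most \<open>exp n\<close>, because
  \<open>2 \<le> exp 1\<close>.\<close>

lemma prob_typical:
  assumes n: "0 < n" and m: "0 < m" and p: "0 < p" and \<epsilon>: "0 \<le> \<epsilon>" "\<epsilon> \<le> 1"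
    and \<epsilon>_lower: "1 \<le> \<epsilon>\<^sup>2 * (real n * p)"
    and rare: "real m * exp (- (\<epsilon>\<^sup>2 * (real n * p))) \<le> real n" and \<theta>: "0 < \<theta>"
  shows "1 - (1 / (\<epsilon>\<^sup>2 * (real n * p)) + 1 / (\<epsilon>\<^sup>2 * (real m * p)) + exp (- 2 * real n)
      + real m * p\<^sup>2 / \<theta>) \<le> prob {X. typical_assignment n m p \<epsilon> \<theta> X}"
proof -
  let ?\<mu> = "real m * (real n * p)\<^sup>2"
  define A where "A = {X. \<epsilon>\<^sup>2 * ?\<mu> < (\<Sum>w<m. (occ X {..<n} w - real n * p)\<^sup>2)}"
  define B where "B = {X. \<epsilon>\<^sup>2 * (real n * (real m * p)\<^sup>2) < (\<Sum>v<n. (num_attrs m X v - real m * p)\<^sup>2)}"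
  define C where "C S = {X. 5 * n < card {w \<in> {..<m}. p * real (card S) + 2 * \<epsilon> * (real n * p) < occ X S w}}" for S
  define D where "D = {X. \<theta> * ?\<mu> < (\<Sum>u<n. \<Sum>v\<in>{..<n} - {u}. common m X u v * (common m X u v - 1))}"
  have "\<epsilon> \<noteq> 0" using \<epsilon>_lower by auto
  then have pos: "0 < \<epsilon>\<^sup>2" by simp
  have "prob A \<le> real m * (real n * p) / (\<epsilon>\<^sup>2 * ?\<mu>)"
    unfolding A_def using n m p pos by (intro prob_occ_dev) auto
  also have "\<dots> = 1 / (\<epsilon>\<^sup>2 * (real n * p))"
    using n m p pos by (simp add: field_simps power2_eq_square)
  finally have A: "prob A \<le> 1 / (\<epsilon>\<^sup>2 * (real n * p))" .
  have "prob B \<le> real n * (real m * p) / (\<epsilon>\<^sup>2 * (real n * (real m * p)\<^sup>2))"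
    unfolding B_def using n m p pos by (intro prob_num_attrs_dev) auto
  also have "\<dots> = 1 / (\<epsilon>\<^sup>2 * (real m * p))"
    using n m p pos by (simp add: field_simps power2_eq_square)
  finally have B: "prob B \<le> 1 / (\<epsilon>\<^sup>2 * (real m * p))" .
  have "prob D \<le> (real n)\<^sup>2 * ((real m)\<^sup>2 * p ^ 4) / (\<theta> * ?\<mu>)"
    unfolding D_def using n m p \<theta> by (intro prob_multiple) auto
  also have "\<dots> = real m * p\<^sup>2 / \<theta>"
    using n m p \<theta> by (simp add: field_simps power2_eq_square power4_eq_xxxx)
  finally have D: "prob D \<le> real m * p\<^sup>2 / \<theta>" .
  have "prob (\<Union>S\<in>Pow {..<n}. C S) \<le> (\<Sum>S\<in>Pow {..<n}. prob (C S))"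
    by (intro measure_pmf.finite_measure_subadditive_finite) auto
  also have "\<dots> \<le> (\<Sum>S\<in>Pow {..<n}. exp (- 3 * real n))"
    unfolding C_def using \<epsilon> rare by (intro sum_mono prob_many_crowded) auto
  also have "\<dots> = 2 ^ n * exp (- 3 * real n)" by (simp add: card_Pow)
  also have "\<dots> \<le> exp 1 ^ n * exp (- 3 * real n)"
    using exp_ge_add_one_self[of 1] by (intro mult_right_mono power_mono) auto
  also have "\<dots> = exp (- 2 * real n)" by (simp flip: exp_of_nat_mult exp_add)
  finally have C: "prob (\<Union>S\<in>Pow {..<n}. C S) \<le> exp (- 2 * real n)" .
  let ?bad = "A \<union> B \<union> (\<Union>S\<in>Pow {..<n}. C S) \<union> D"
  have "prob ?bad \<le> prob A + prob B + prob (\<Union>S\<in>Pow {..<n}. C S) + prob D"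
    by (intro order_trans[OF measure_Un_le] add_mono order_refl) auto
  moreover have "- ?bad \<subseteq> {X. typical_assignment n m p \<epsilon> \<theta> X}"
    using n m p \<epsilon> \<epsilon>_lower
    by (auto simp: A_def B_def C_def D_def not_less typical_assignment_def)
  then have "prob (- ?bad) \<le> prob {X. typical_assignment n m p \<epsilon> \<theta> X}"
    by (intro measure_pmf.finite_measure_mono) auto
  moreover have "prob (- ?bad) = 1 - prob ?bad"
    using measure_pmf.prob_compl[of ?bad assignment] by (simp add: Compl_eq_Diff_UNIV)
  ultimately show ?thesis using A B C D by linarith
qed

text \<open>Pulls the event on graphs back to assignments. A free \<Delta> separates the bound to be
  claimed from the value of \<theta> used in the probability estimate.\<close>

lemma prob_graph_modularity:
  assumes "0 < n" "0 < m" "0 < p" "0 \<le> \<epsilon>" "1 \<le> \<epsilon>\<^sup>2 * (real n * p)"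
    and "real m * exp (- (\<epsilon>\<^sup>2 * (real n * p))) \<le> real n" "0 < \<theta>"
    and small: "\<epsilon> + real n / real m + \<theta> \<le> 1 / 100"
    and \<Delta>: "100 * (\<epsilon> + real n / real m + \<theta>) \<le> \<Delta>"
  shows "1 - (1 / (\<epsilon>\<^sup>2 * (real n * p)) + 1 / (\<epsilon>\<^sup>2 * (real m * p)) + exp (- 2 * real n)
      + real m * p\<^sup>2 / \<theta>)
    \<le> measure_pmf.prob (random_intersection_graph n m p) {G. edges G \<noteq> {} \<and> \<bar>modularity G\<bar> \<le> \<Delta>}"
proof -
  have "0 \<le> real n / real m" by simp
  then have "\<epsilon> \<le> 1" using small \<open>0 < \<theta>\<close> by linarith
  then have "1 - (1 / (\<epsilon>\<^sup>2 * (real n * p)) + 1 / (\<epsilon>\<^sup>2 * (real m * p)) + exp (- 2 * real n)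
      + real m * p\<^sup>2 / \<theta>) \<le> prob {X. typical_assignment n m p \<epsilon> \<theta> X}"
    using assms by (intro prob_typical) auto
  also have "\<dots> \<le> prob (intersection_graph n m -` {G. edges G \<noteq> {} \<and> \<bar>modularity G\<bar> \<le> \<Delta>})"
  proof (rule measure_pmf.finite_measure_mono)
    show "{X. typical_assignment n m p \<epsilon> \<theta> X}
      \<subseteq> intersection_graph n m -` {G. edges G \<noteq> {} \<and> \<bar>modularity G\<bar> \<le> \<Delta>}"
      using typical_assignment.abs_modularity_typical[OF _ small] \<open>0 < \<theta>\<close> \<Delta> by fastforce
  qed simp
  finally show ?thesis by (simp add: random_intersection_graph_def)
qed

end

text \<open>Demanding an edge in the event excludes the edgeless graph, on which
  \<open>modularity\<close> has only a default value.\<close>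

theorem theorem2:
  fixes m :: "nat \<Rightarrow> nat" and p :: "nat \<Rightarrow> real" and \<omega> :: "nat \<Rightarrow> real"
  assumes "\<And>n. 0 \<le> p n \<and> p n \<le> 1"
    and "filterlim m at_top sequentially"
    and "p \<longlonglongrightarrow> 0"
    and "(\<lambda>n. real (m n) * (p n)\<^sup>2) \<in> o(\<lambda>_. 1)"
    and "filterlim (\<lambda>n. (real n)\<^sup>2 * real (m n) * (p n)\<^sup>2) at_top sequentially"
    and "(\<lambda>n. real n) \<in> o(\<lambda>n. real (m n))"
    and "filterlim (\<lambda>n. real n * p n / ln (real (m n) / real n)) at_top sequentially"
    and "filterlim \<omega> at_top sequentially"
  shows "\<exists>C>0. (\<lambda>n. measure_pmf.prob (random_intersection_graph n (m n) (p n))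
            {G. edges G \<noteq> {} \<and>
                \<bar>modularity G\<bar> \<le> C * (sqrt (ln (real (m n) / real n) / (real n * p n))
                                   + real n / real (m n) + \<omega> n * real (m n) * (p n)\<^sup>2)})
          \<longlonglongrightarrow> 1"
proof -
  define L where "L n = ln (real (m n) / real n)" for n
  define \<epsilon> where "\<epsilon> n = sqrt (L n / (real n * p n))" for n
  define q where "q n = real (m n) * (p n)\<^sup>2" for n
  text \<open>Capping \<open>\<omega>\<close> makes the error term tend to 0, so that the graph has edges even if
    \<open>\<omega> m p\<^sup>2\<close> does not.\<close>
  define \<theta> where "\<theta> n = min (\<omega> n * q n) (sqrt (q n))" for n
  \<comment> \<open>The choice of \<epsilon> gives \<open>\<epsilon>^2 * n * p = L\<close>, whence
    the first \<open>1 / L\<close>; the second uses \<open>n \<le> m\<close>. The last two terms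
    cover both branches of the minimum in \<theta>.\<close>
  define err where "err n = 1 / L n + 1 / L n + exp (- 2 * real n) + (1 / \<omega> n + sqrt (q n))" for n
  let ?prob = "\<lambda>n. measure_pmf.prob (random_intersection_graph n (m n) (p n))
    {G. edges G \<noteq> {} \<and> \<bar>modularity G\<bar> \<le> 100 * (\<epsilon> n + real n / real (m n) + \<omega> n * real (m n) * (p n)\<^sup>2)}"

  have n_pos: "\<forall>\<^sub>F n in sequentially. 0 < n" by (rule eventually_gt_at_top)
  have m_pos: "\<forall>\<^sub>F n in sequentially. 0 < m n"
    by (rule eventually_compose_filterlim[OF eventually_gt_at_top assms(2)])
  have \<omega>_pos: "\<forall>\<^sub>F n in sequentially. 0 < \<omega> n"
    using assms(8) by (simp add: filterlim_at_top_dense)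
  have n_over_m: "(\<lambda>n. real n / real (m n)) \<longlonglongrightarrow> 0"
    using assms(6) by (rule smalloD_tendsto)
  have "\<forall>\<^sub>F n in sequentially. 0 < real n / real (m n)"
    using n_pos m_pos by eventually_elim simp
  then have "filterlim (\<lambda>n. inverse (real n / real (m n))) at_top sequentially"
    by (rule filterlim_inverse_at_top[OF n_over_m])
  then have L_top: "filterlim L at_top sequentially"
    unfolding L_def by (intro filterlim_compose[OF ln_at_top]) simp
  have L_ge_1: "\<forall>\<^sub>F n in sequentially. 1 \<le> L n"
    using L_top by (simp add: filterlim_at_top)
  have "\<forall>\<^sub>F n in sequentially. 0 < real n * p n / L n"
    using assms(7) by (simp add: filterlim_at_top_dense L_def)
  with L_ge_1 have np_pos: "\<forall>\<^sub>F n in sequentially. 0 < real n * p n"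
    by eventually_elim (simp add: zero_less_divide_iff)
  have "(\<lambda>n. inverse (real n * p n / L n)) \<longlonglongrightarrow> 0"
    using assms(7) unfolding L_def by (rule tendsto_inverse_0_at_top)
  then have "(\<lambda>n. sqrt (inverse (real n * p n / L n))) \<longlonglongrightarrow> sqrt 0"
    by (rule tendsto_real_sqrt)
  then have \<epsilon>_lim: "\<epsilon> \<longlonglongrightarrow> 0" by (simp add: \<epsilon>_def[abs_def])
  have "q \<longlonglongrightarrow> 0" using smalloD_tendsto[OF assms(4)] by (simp add: q_def[abs_def])
  then have "(\<lambda>n. sqrt (q n)) \<longlonglongrightarrow> sqrt 0" by (rule tendsto_real_sqrt)
  then have sqrt_q_lim: "(\<lambda>n. sqrt (q n)) \<longlonglongrightarrow> 0" by simp
  have "(\<lambda>n. \<epsilon> n + real n / real (m n) + sqrt (q n)) \<longlonglongrightarrow> 0 + 0 + 0"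
    by (intro tendsto_add \<epsilon>_lim n_over_m sqrt_q_lim)
  then have small: "\<forall>\<^sub>F n in sequentially. \<epsilon> n + real n / real (m n) + sqrt (q n) < 1 / 100"
    by (rule order_tendstoD) simp

  have lower: "\<forall>\<^sub>F n in sequentially. 1 - err n \<le> ?prob n"
    using n_pos m_pos \<omega>_pos L_ge_1 np_pos small
  proof eventually_elim
    case (elim n)
    interpret random_assignment n "m n" "p n" by unfold_locales (use assms(1) in auto)
    have p_pos: "0 < p n" using elim by (simp add: zero_less_mult_iff)
    have q_pos: "0 < q n" using p_pos elim by (simp add: q_def)
    have \<theta>_pos: "0 < \<theta> n" using q_pos elim by (simp add: \<theta>_def)
    have \<epsilon>_nonneg: "0 \<le> \<epsilon> n" using elim p_pos by (simp add: \<epsilon>_def)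
    have \<epsilon>_sq: "(\<epsilon> n)\<^sup>2 = L n / (real n * p n)" using elim p_pos by (simp add: \<epsilon>_def)
    then have \<epsilon>_sq_np: "(\<epsilon> n)\<^sup>2 * (real n * p n) = L n" using elim p_pos by simp
    have exp_L: "exp (L n) = real (m n) / real n" using elim by (simp add: L_def)
    have "n \<le> m n"
    proof -
      have "1 \<le> exp (L n)" using elim by simp
      then show ?thesis using exp_L elim by (simp add: field_simps)
    qed
    have "L n = (\<epsilon> n)\<^sup>2 * (real n * p n)" using \<epsilon>_sq_np ..
    also have "\<dots> \<le> (\<epsilon> n)\<^sup>2 * (real (m n) * p n)"
      using \<open>n \<le> m n\<close> p_pos by (intro mult_left_mono mult_right_mono) auto
    finally have L_le: "L n \<le> (\<epsilon> n)\<^sup>2 * (real (m n) * p n)" .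
    have "1 - (1 / ((\<epsilon> n)\<^sup>2 * (real n * p n)) + 1 / ((\<epsilon> n)\<^sup>2 * (real (m n) * p n)) + exp (- 2 * real n)
        + real (m n) * (p n)\<^sup>2 / \<theta> n) \<le> ?prob n"
    proof (rule prob_graph_modularity)
      \<comment> \<open>This holds with equality, as \<open>exp (L n)\<close> is
        \<open>m / n\<close>: the logarithm in the theorem is exactly what the Chernoff bound
        requires.\<close>
      show "real (m n) * exp (- ((\<epsilon> n)\<^sup>2 * (real n * p n))) \<le> real n"
        using elim by (simp add: \<epsilon>_sq_np exp_minus exp_L)
      show "\<epsilon> n + real n / real (m n) + \<theta> n \<le> 1 / 100"
        using elim by (auto simp: \<theta>_def)
      show "100 * (\<epsilon> n + real n / real (m n) + \<theta> n)
          \<le> 100 * (\<epsilon> n + real n / real (m n) + \<omega> n * real (m n) * (p n)\<^sup>2)"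
        by (simp add: \<theta>_def q_def)
    qed (use elim p_pos \<theta>_pos \<epsilon>_nonneg \<epsilon>_sq_np in auto)
    moreover have "1 / ((\<epsilon> n)\<^sup>2 * (real (m n) * p n)) \<le> 1 / L n"
      using L_le elim by (intro divide_left_mono) auto
    \<comment> \<open>The left side is the larger of \<open>1 / \<omega> n\<close> and
      \<open>sqrt (q n)\<close>, according to which term attains the minimum.\<close>
    moreover have "real (m n) * (p n)\<^sup>2 / \<theta> n \<le> 1 / \<omega> n + sqrt (q n)"
    proof (cases "\<omega> n * q n \<le> sqrt (q n)")
      case True
      then have "q n / \<theta> n = 1 / \<omega> n" using q_pos by (simp add: \<theta>_def)
      then show ?thesis using q_pos by (simp add: q_def)
    next
      case False
      then have "q n / \<theta> n = sqrt (q n)"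
        using q_pos by (simp add: \<theta>_def real_div_sqrt)
      then show ?thesis using elim by (simp add: q_def)
    qed
    ultimately show ?case by (simp add: err_def \<epsilon>_sq_np)
  qed
  have lower_lim: "(\<lambda>n. 1 - err n) \<longlonglongrightarrow> 1"
  proof -
    have "(\<lambda>n. exp (- 2 * real n)) \<longlonglongrightarrow> 0" by real_asymp
    moreover have "(\<lambda>n. 1 / L n) \<longlonglongrightarrow> 0" "(\<lambda>n. 1 / \<omega> n) \<longlonglongrightarrow> 0"
      using tendsto_inverse_0_at_top[OF L_top] tendsto_inverse_0_at_top[OF assms(8)]
      by (simp_all add: inverse_eq_divide)
    ultimately have "(\<lambda>n. 1 - err n) \<longlonglongrightarrow> 1 - (0 + 0 + 0 + (0 + 0))"
      unfolding err_def by (intro tendsto_diff tendsto_add tendsto_const sqrt_q_lim)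
    then show ?thesis by simp
  qed
  have "?prob \<longlonglongrightarrow> 1"
    by (rule tendsto_sandwich[OF lower _ lower_lim tendsto_const]) simp
  then show ?thesis
    unfolding \<epsilon>_def L_def by (rule exI[of _ 100, OF conjI, rotated]) simp
qed

end
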